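(* Let $(S,T,\sigma)$ be a normal subcrossed module of a crossed module $(A,B,\alpha)$ in $\mathsf{C}$. Then $(A/S,B/T,\alpha^{\ast})$ is a crossed module in $\mathsf{C}$ (the quotient crossed module), where $A/S$ and $B/T$ are the quotient groups with operations, $\alpha^{\ast}\colon A/S\to B/T$ is given by $\alpha^{\ast}([a])=[\alpha(a)]$, and the actions of $B/T$ on $A/S$ are $[b]\cdot[a]=[b\cdot a]$ and $[b]\star[a]=[b\star a]$ for $a\in A$, $b\in B$, $\star\in\Omega_2'$ (in particular these maps are well defined).
   Context: Groups with operations. $\mathsf{C}$ is a fixed category of groups with operations: its objects are the algebras with a set $\Omega$ of operations satisfying a set $\mathsf{E}$ of identities, where $\mathsf{E}$ includes the group laws and, with $\Omega_i$ the set of $i$-ary operations: (a) $\Omega=\Omega_0\cup\Omega_1\cup\Omega_2$; (b) the group operations $0,-,+$ (written additively, $+$ not necessarily commutative) belong to $\Omega_0,\Omega_1,\Omega_2$ respectively, $\Omega_0=\{0\}$, and with $\Omega_1'=\Omega_1\setminus\{-\}$, $\Omega_2'=\Omega_2\setminus\{+\}$, if $\star\in\Omega_2'$ then the operation $a\star^{\circ}b=b\star a$ is also in $\Omega_2'$; (c) for each $\star\in\Omega_2'$, $\mathsf{E}$ includes $a\star(b+c)=a\star b+a\star c$; (d) for $\omega\in\Omega_1'$, $\star\in\Omega_2'$, $\mathsf{E}$ includes $\omega(a+b)=\omega(a)+\omega(b)$ and $\omega(a)\star b=\omega(a\star b)$. Morphisms are group homomorphisms preserving all operations in $\Omega_1'$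 and $\Omega_2'$. A subobject is a subset containing $0$ and closed under all operations. An ideal $N$ of $A$ is a subobject with $(N,+)$ normal in $(A,+)$ and $a\star n\in N$ for all $a\in A$, $n\in N$, $\star\in\Omega_2'$; $A/N$ is the set of classes of $a\sim a_1\iff a-a_1\in N$ with induced operations, again an object of $\mathsf{C}$. Derived actions. Derived actions of $B$ on $A$ (objects of $\mathsf{C}$) are the maps $b\cdot a=s(b)+a-s(b)$ and $b\star a=s(b)\star a$ ($\star\in\Omega_2'$) obtained from a split extension $0\to A\to E\xrightarrow{p}B\to 0$ in $\mathsf{C}$ ($p$ surjective, $A=\ker p$, $s\colon B\to E$ a morphism with $ps=\mathrm{id}_B$). One writes $a\star b:=b\star^{\circ}a$. Crossed modules. A crossed module $(A,B,\alpha)$ in $\mathsf{C}$ consists of objects $A,B$, derived actions of $B$ on $A$, and a morphism $\alpha\colon A\to B$ in $\mathsf{C}$ such that for all $b\in B$, $a,a'\in A$, $\star\in\Omega_2'$: (CM1) $\alpha(b\cdot a)=b+\alpha(a)-b$; (CM2) $\alpha(a)\cdot a'=a+a'-a$; (CM3) $\alpha(a)\star a'=a\star a'$; (CM4) $\alpha(b\star a)=b\star\alpha(a)$ and $\alpha(a\star b)=\alpha(a)\star b$. A crossed module $(S,T,\sigma)$ is a subcrossed module of $(A,B,\alpha)$ if $S\subseteq A$ and $T\subseteq B$ are subobjects, $\sigma$ is the restriction of $\alpha$, and the actions of $T$ on $S$ are induced by those of $B$ on $A$. It is normal if: $T$ is an ideal of $B$; $b\cdot s\in S$ for all $b\in B,s\in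 S$; $(t\cdot a)-a\in S$ for all $t\in T,a\in A$; $b\star s\in S$ for all $b\in B,s\in S$; $t\star a\in S$ for all $t\in T,a\in A$ (all $\star\in\Omega_2'$). In a normal subcrossed module $S$ is automatically an ideal of $A$. *)

theory Defs
  imports "HOL-Algebra.Coset"
begin

section \<open>Categories of groups with operations\<close>

text \<open>
  Groups are those of HOL-Algebra, hence written multiplicatively: the operations
  \<open>0\<close>, \<open>-\<close>, \<open>+\<close> of a (not necessarily commutative) group with operations are \<open>\<one>\<close>, \<open>inv\<close>, \<open>\<otimes>\<close>.
  The symbols in \<open>\<Omega>\<^sub>1 - {-}\<close> have type \<open>'u\<close>, those in \<open>\<Omega>\<^sub>2 - {+}\<close> have type \<open>'o\<close>.
\<close>

datatype (unsyms: 'u, binsyms: 'o) gterm =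
    Var nat
  | Zero
  | Minus "('u, 'o) gterm"
  | Plus "('u, 'o) gterm" "('u, 'o) gterm"
  | Unary 'u "('u, 'o) gterm"
  | Binary 'o "('u, 'o) gterm" "('u, 'o) gterm"

record ('u, 'o) gwo_theory =
  unops :: "'u set"
  binops :: "'o set"
  opp :: "'o \<Rightarrow> 'o"  \<comment> \<open>the opposite operation \<open>\<star>\<^sup>\<circ>\<close>\<close>
  idents :: "(('u, 'o) gterm \<times> ('u, 'o) gterm) set"

definition group_laws :: "(('u, 'o) gterm \<times> ('u, 'o) gterm) set" where
  "group_laws =
    {(Plus (Plus (Var 0) (Var 1)) (Var 2), Plus (Var 0) (Plus (Var 1) (Var 2))),
     (Plus Zero (Var 0), Var 0), (Plus (Var 0) Zero, Var 0),
     (Plus (Minus (Var 0)) (Var 0), Zero), (Plus (Var 0) (Minus (Var 0)), Zero)}"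

text \<open>
  The set of identities is arbitrary beyond the ones listed; it may hold further identities,
  cutting out the category among all algebras of the signature.
\<close>

definition groups_with_operations :: "('u, 'o) gwo_theory \<Rightarrow> bool" where
  "groups_with_operations \<Theta> \<longleftrightarrow>
    (\<forall>(l, r) \<in> idents \<Theta>. unsyms l \<union> unsyms r \<subseteq> unops \<Theta> \<and> binsyms l \<union> binsyms r \<subseteq> binops \<Theta>) \<and>
    group_laws \<subseteq> idents \<Theta> \<and>
    (\<forall>m \<in> binops \<Theta>. opp \<Theta> m \<in> binops \<Theta> \<and>
      (Binary (opp \<Theta> m) (Var 0) (Var 1), Binary m (Var 1) (Var 0)) \<in> idents \<Theta>) \<and>
    (\<forall>m \<in> binops \<Theta>.
      (Binary m (Var 0) (Plus (Var 1) (Var 2)),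
       Plus (Binary m (Var 0) (Var 1)) (Binary m (Var 0) (Var 2))) \<in> idents \<Theta>) \<and>
    (\<forall>w \<in> unops \<Theta>.
      (Unary w (Plus (Var 0) (Var 1)), Plus (Unary w (Var 0)) (Unary w (Var 1))) \<in> idents \<Theta>) \<and>
    (\<forall>w \<in> unops \<Theta>. \<forall>m \<in> binops \<Theta>.
      (Binary m (Unary w (Var 0)) (Var 1), Unary w (Binary m (Var 0) (Var 1))) \<in> idents \<Theta>)"

record ('a, 'u, 'o) gwo = "'a monoid" +
  unary :: "'u \<Rightarrow> 'a \<Rightarrow> 'a"
  binary :: "'o \<Rightarrow> 'a \<Rightarrow> 'a \<Rightarrow> 'a"

fun eval_gterm :: "('a, 'u, 'o) gwo \<Rightarrow> (nat \<Rightarrow> 'a) \<Rightarrow> ('u, 'o) gterm \<Rightarrow> 'a" where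
  "eval_gterm A v (Var n) = v n"
| "eval_gterm A v Zero = \<one>\<^bsub>A\<^esub>"
| "eval_gterm A v (Minus t) = inv\<^bsub>A\<^esub> (eval_gterm A v t)"
| "eval_gterm A v (Plus t u) = eval_gterm A v t \<otimes>\<^bsub>A\<^esub> eval_gterm A v u"
| "eval_gterm A v (Unary w t) = unary A w (eval_gterm A v t)"
| "eval_gterm A v (Binary m t u) = binary A m (eval_gterm A v t) (eval_gterm A v u)"

text \<open>
  \<open>group A\<close> is required although the group laws are identities, because \<open>inv\<close> is a
  derived notion of HOL-Algebra that is meaningful only in a group.
\<close>

definition gwo_object :: "('u, 'o) gwo_theory \<Rightarrow> ('a, 'u, 'o) gwo \<Rightarrow> bool" where
  "gwo_object \<Theta> A \<longleftrightarrow> group A \<and>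
    (\<forall>w \<in> unops \<Theta>. \<forall>a \<in> carrier A. unary A w a \<in> carrier A) \<and>
    (\<forall>m \<in> binops \<Theta>. \<forall>a \<in> carrier A. \<forall>b \<in> carrier A. binary A m a b \<in> carrier A) \<and>
    (\<forall>(l, r) \<in> idents \<Theta>. \<forall>v. range v \<subseteq> carrier A \<longrightarrow> eval_gterm A v l = eval_gterm A v r)"

definition gwo_hom ::
    "('u, 'o) gwo_theory \<Rightarrow> ('a, 'u, 'o) gwo \<Rightarrow> ('b, 'u, 'o) gwo \<Rightarrow> ('a \<Rightarrow> 'b) set" where
  "gwo_hom \<Theta> A B = {f \<in> hom A B.
    (\<forall>w \<in> unops \<Theta>. \<forall>a \<in> carrier A. f (unary A w a) = unary B w (f a)) \<and>
    (\<forall>m \<in> binops \<Theta>. \<forall>a \<in> carrier A. \<forall>a' \<in> carrier A.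
      f (binary A m a a') = binary B m (f a) (f a'))}"

definition gwo_subobject :: "('u, 'o) gwo_theory \<Rightarrow> 'a set \<Rightarrow> ('a, 'u, 'o) gwo \<Rightarrow> bool" where
  "gwo_subobject \<Theta> S A \<longleftrightarrow> subgroup S A \<and>
    (\<forall>w \<in> unops \<Theta>. \<forall>s \<in> S. unary A w s \<in> S) \<and>
    (\<forall>m \<in> binops \<Theta>. \<forall>s \<in> S. \<forall>s' \<in> S. binary A m s s' \<in> S)"

definition gwo_ideal :: "('u, 'o) gwo_theory \<Rightarrow> 'a set \<Rightarrow> ('a, 'u, 'o) gwo \<Rightarrow> bool" where
  "gwo_ideal \<Theta> N A \<longleftrightarrow> gwo_subobject \<Theta> N A \<and> N \<lhd> A \<and>
    (\<forall>m \<in> binops \<Theta>. \<forall>a \<in> carrier A. \<forall>n \<in> N. binary A m a n \<in> N)"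

text \<open>
  The class of \<open>a\<close> under \<open>a \<sim> a' \<longleftrightarrow> a - a' \<in> N\<close> is the right coset \<open>N #>\<^bsub>A\<^esub> a\<close>.
  Induced operations are unions over all representatives; such a union is again a
  coset exactly when the operation is well defined on the cosets concerned.
\<close>

definition gwo_quotient :: "('a, 'u, 'o) gwo \<Rightarrow> 'a set \<Rightarrow> ('a set, 'u, 'o) gwo" where
  "gwo_quotient A N =
    \<lparr>carrier = carrier (A Mod N), mult = mult (A Mod N), one = one (A Mod N),
     unary = (\<lambda>w X. \<Union>x\<in>X. N #>\<^bsub>A\<^esub> unary A w x),
     binary = (\<lambda>m X Y. \<Union>x\<in>X. \<Union>y\<in>Y. N #>\<^bsub>A\<^esub> binary A m x y)\<rparr>"


section \<open>Derived actions\<close>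

definition split_extension ::
    "('u, 'o) gwo_theory \<Rightarrow> ('a, 'u, 'o) gwo \<Rightarrow> ('e, 'u, 'o) gwo \<Rightarrow> ('b, 'u, 'o) gwo
      \<Rightarrow> ('a \<Rightarrow> 'e) \<Rightarrow> ('e \<Rightarrow> 'b) \<Rightarrow> ('b \<Rightarrow> 'e) \<Rightarrow> bool" where
  "split_extension \<Theta> A E B i p s \<longleftrightarrow>
    gwo_object \<Theta> A \<and> gwo_object \<Theta> E \<and> gwo_object \<Theta> B \<and>
    i \<in> gwo_hom \<Theta> A E \<and> p \<in> gwo_hom \<Theta> E B \<and> s \<in> gwo_hom \<Theta> B E \<and>
    inj_on i (carrier A) \<and> i ` carrier A = kernel E B p \<and>
    p ` carrier E = carrier B \<and> (\<forall>b \<in> carrier B. p (s b) = b)"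

text \<open>The actions are \<open>b \<cdot> a = s(b) + a - s(b)\<close> and \<open>b \<star> a = s(b) \<star> a\<close>, with \<open>A\<close> embedded by \<open>i\<close>.\<close>

definition actions_from ::
    "('u, 'o) gwo_theory \<Rightarrow> ('a, 'u, 'o) gwo \<Rightarrow> ('e, 'u, 'o) gwo \<Rightarrow> ('b, 'u, 'o) gwo
      \<Rightarrow> ('a \<Rightarrow> 'e) \<Rightarrow> ('b \<Rightarrow> 'e) \<Rightarrow> ('b \<Rightarrow> 'a \<Rightarrow> 'a) \<Rightarrow> ('o \<Rightarrow> 'b \<Rightarrow> 'a \<Rightarrow> 'a) \<Rightarrow> bool" where
  "actions_from \<Theta> A E B i s dot star \<longleftrightarrow>
    (\<forall>b \<in> carrier B. \<forall>a \<in> carrier A.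
      dot b a \<in> carrier A \<and> i (dot b a) = s b \<otimes>\<^bsub>E\<^esub> i a \<otimes>\<^bsub>E\<^esub> inv\<^bsub>E\<^esub> (s b)) \<and>
    (\<forall>m \<in> binops \<Theta>. \<forall>b \<in> carrier B. \<forall>a \<in> carrier A.
      star m b a \<in> carrier A \<and> i (star m b a) = binary E m (s b) (i a))"

text \<open>
  The middle object is taken on the type \<open>'a \<times> 'b\<close>, as HOL cannot quantify over its type.
  This loses nothing, the carrier being in bijection with \<open>A \<times> B\<close>:
  see \<open>derived_actionsI\<close> below, where the type of \<open>E\<close> is arbitrary.
\<close>

definition derived_actions ::
    "('u, 'o) gwo_theory \<Rightarrow> ('a, 'u, 'o) gwo \<Rightarrow> ('b, 'u, 'o) gwo
      \<Rightarrow> ('b \<Rightarrow> 'a \<Rightarrow> 'a) \<Rightarrow> ('o \<Rightarrow> 'b \<Rightarrow> 'a \<Rightarrow> 'a) \<Rightarrow> bool" where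
  "derived_actions \<Theta> A B dot star \<longleftrightarrow>
    (\<exists>(E :: ('a \<times> 'b, 'u, 'o) gwo) i p s.
      split_extension \<Theta> A E B i p s \<and> actions_from \<Theta> A E B i s dot star)"

definition gwo_transport :: "('e, 'u, 'o) gwo \<Rightarrow> ('e \<Rightarrow> 'f) \<Rightarrow> ('f, 'u, 'o) gwo" where
  "gwo_transport E f = (let g = inv_into (carrier E) f in
    \<lparr>carrier = f ` carrier E, mult = (\<lambda>x y. f (g x \<otimes>\<^bsub>E\<^esub> g y)), one = f \<one>\<^bsub>E\<^esub>,
     unary = (\<lambda>w x. f (unary E w (g x))), binary = (\<lambda>m x y. f (binary E m (g x) (g y)))\<rparr>)"

lemma gwo_transport_simps:
  assumes "inj_on f (carrier E)"
  shows "carrier (gwo_transport E f) = f ` carrier E"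
    and "\<one>\<^bsub>gwo_transport E f\<^esub> = f \<one>\<^bsub>E\<^esub>"
    and "\<And>x y. x \<in> carrier E \<Longrightarrow> y \<in> carrier E \<Longrightarrow> f x \<otimes>\<^bsub>gwo_transport E f\<^esub> f y = f (x \<otimes>\<^bsub>E\<^esub> y)"
    and "\<And>w x. x \<in> carrier E \<Longrightarrow> unary (gwo_transport E f) w (f x) = f (unary E w x)"
    and "\<And>m x y. x \<in> carrier E \<Longrightarrow> y \<in> carrier E \<Longrightarrow>
      binary (gwo_transport E f) m (f x) (f y) = f (binary E m x y)"
  using assms by (simp_all add: gwo_transport_def Let_def)

lemma group_transport:
  assumes "group E" and inj: "inj_on f (carrier E)"
  shows "group (gwo_transport E f)"
    and "\<And>x. x \<in> carrier E \<Longrightarrow> inv\<^bsub>gwo_transport E f\<^esub> (f x) = f (inv\<^bsub>E\<^esub> x)"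
proof -
  interpret E: group E by fact
  show *: "group (gwo_transport E f)"
  proof (rule groupI)
    fix x assume "x \<in> carrier (gwo_transport E f)"
    then obtain u where u: "u \<in> carrier E" "x = f u" by (auto simp: gwo_transport_simps[OF inj])
    then show "\<exists>y\<in>carrier (gwo_transport E f). y \<otimes>\<^bsub>gwo_transport E f\<^esub> x = \<one>\<^bsub>gwo_transport E f\<^esub>"
      by (intro bexI[of _ "f (inv\<^bsub>E\<^esub> u)"]) (auto simp: gwo_transport_simps[OF inj])
  qed (auto simp: gwo_transport_simps[OF inj] E.m_assoc)
  show "inv\<^bsub>gwo_transport E f\<^esub> (f x) = f (inv\<^bsub>E\<^esub> x)" if "x \<in> carrier E" for x
    using that by (intro group.inv_equality[OF *]) (auto simp: gwo_transport_simps[OF inj])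
qed

lemma eval_gterm_closed:
  assumes "gwo_object \<Theta> E" "range v \<subseteq> carrier E" "unsyms t \<subseteq> unops \<Theta>" "binsyms t \<subseteq> binops \<Theta>"
  shows "eval_gterm E v t \<in> carrier E"
proof -
  interpret E: group E using assms(1) by (simp add: gwo_object_def)
  show ?thesis using assms by (induction t) (auto simp: gwo_object_def)
qed

lemma gwo_object_transport:
  assumes th: "groups_with_operations \<Theta>" and obj: "gwo_object \<Theta> E" and inj: "inj_on f (carrier E)"
  shows "gwo_object \<Theta> (gwo_transport E f)"
proof -
  let ?F = "gwo_transport E f"
  interpret E: group E using obj by (simp add: gwo_object_def)
  note simps = gwo_transport_simps[OF inj] group_transport[OF E.group_axioms inj]
  have ev: "eval_gterm ?F (\<lambda>n. f (v n)) t = f (eval_gterm E v t)"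
    if "range v \<subseteq> carrier E" "unsyms t \<subseteq> unops \<Theta>" "binsyms t \<subseteq> binops \<Theta>" for v t
    using that by (induction t) (simp_all add: simps eval_gterm_closed[OF obj])
  have "eval_gterm ?F v l = eval_gterm ?F v r"
    if lr: "(l, r) \<in> idents \<Theta>" and v: "range v \<subseteq> carrier ?F" for l r v
  proof -
    define u where "u n = inv_into (carrier E) f (v n)" for n
    have vn: "v n \<in> f ` carrier E" for n using v by (auto simp: simps)
    then have u: "range u \<subseteq> carrier E" "v = (\<lambda>n. f (u n))"
      by (auto simp: u_def f_inv_into_f inv_into_into[OF vn])
    moreover have "unsyms l \<union> unsyms r \<subseteq> unops \<Theta>" "binsyms l \<union> binsyms r \<subseteq> binops \<Theta>"
      using th lr unfolding groups_with_operations_def by blast+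
    moreover have "eval_gterm E u l = eval_gterm E u r"
      using obj lr u(1) unfolding gwo_object_def by blast
    ultimately show ?thesis using ev[of u l] ev[of u r] by simp
  qed
  moreover have "unary ?F w x \<in> carrier ?F" if "w \<in> unops \<Theta>" "x \<in> carrier ?F" for w x
    using that obj by (auto simp: simps gwo_object_def)
  moreover have "binary ?F m x y \<in> carrier ?F"
    if "m \<in> binops \<Theta>" "x \<in> carrier ?F" "y \<in> carrier ?F" for m x y
    using that obj by (auto simp: simps gwo_object_def)
  ultimately show ?thesis unfolding gwo_object_def using simps(6) by blast
qed

lemma derived_actionsI:
  fixes E :: "('e, 'u, 'o) gwo"
  assumes th: "groups_with_operations \<Theta>"
    and ext: "split_extension \<Theta> A E B i p s"
    and act: "actions_from \<Theta> A E B i s dot star"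
  shows "derived_actions \<Theta> A B dot star"
proof -
  have obj: "gwo_object \<Theta> A" "gwo_object \<Theta> E" "gwo_object \<Theta> B"
    and homs: "i \<in> gwo_hom \<Theta> A E" "p \<in> gwo_hom \<Theta> E B" "s \<in> gwo_hom \<Theta> B E"
    and ii: "inj_on i (carrier A)" and ik: "i ` carrier A = kernel E B p"
    and ps: "p ` carrier E = carrier B" "\<And>b. b \<in> carrier B \<Longrightarrow> p (s b) = b"
    using ext by (auto simp: split_extension_def)
  interpret A: group A using obj by (simp add: gwo_object_def)
  interpret E: group E using obj by (simp add: gwo_object_def)
  interpret B: group B using obj by (simp add: gwo_object_def)
  have ph: "p \<in> hom E B" and sh: "s \<in> hom B E" and ih: "i \<in> hom A E"
    using homs by (auto simp: gwo_hom_def)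
  interpret P: group_hom E B p
    using ph by (simp add: group_hom_def group_hom_axioms_def E.group_axioms B.group_axioms)
  have sc: "s b \<in> carrier E" if "b \<in> carrier B" for b using sh that by (auto simp: hom_def)
  have ic: "i a \<in> carrier E" if "a \<in> carrier A" for a using ih that by (auto simp: hom_def)
  define f where "f e = (inv_into (carrier A) i (e \<otimes>\<^bsub>E\<^esub> inv\<^bsub>E\<^esub> (s (p e))), p e)" for e
  have ker: "e \<otimes>\<^bsub>E\<^esub> inv\<^bsub>E\<^esub> (s (p e)) \<in> i ` carrier A" if "e \<in> carrier E" for e
    using that by (simp add: ik kernel_def sc ps)
  have inj: "inj_on f (carrier E)"
  proof (rule inj_onI)
    fix x y assume xy: "x \<in> carrier E" "y \<in> carrier E" "f x = f y"
    then have pe: "p x = p y" by (simp add: f_def)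
    have "x \<otimes>\<^bsub>E\<^esub> inv\<^bsub>E\<^esub> (s (p x)) = y \<otimes>\<^bsub>E\<^esub> inv\<^bsub>E\<^esub> (s (p y))"
      using xy(3) ker[OF xy(1)] ker[OF xy(2)] unfolding f_def by (metis prod.inject inv_into_injective)
    then show "x = y" using xy(1,2) pe sc by (simp add: E.right_cancel)
  qed
  let ?F = "gwo_transport E f" and ?g = "inv_into (carrier E) f"
  note simps = gwo_transport_simps[OF inj] group_transport[OF E.group_axioms inj]
  have g: "?g (f e) = e" if "e \<in> carrier E" for e using inj that by simp
  have un: "unary E w e \<in> carrier E" if "w \<in> unops \<Theta>" "e \<in> carrier E" for w e
    using obj that by (simp add: gwo_object_def)
  have bi: "binary E m e e' \<in> carrier E" if "m \<in> binops \<Theta>" "e \<in> carrier E" "e' \<in> carrier E" for m e e'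
    using obj that by (simp add: gwo_object_def)
  have "split_extension \<Theta> A ?F B (f \<circ> i) (p \<circ> ?g) (f \<circ> s)"
    unfolding split_extension_def
  proof (intro conjI ballI)
    show "gwo_object \<Theta> A" "gwo_object \<Theta> B" "gwo_object \<Theta> ?F"
      using obj gwo_object_transport[OF th _ inj] by auto
    show "f \<circ> i \<in> gwo_hom \<Theta> A ?F"
      using homs(1) by (auto simp: gwo_hom_def hom_def simps ic Pi_iff)
    show "f \<circ> s \<in> gwo_hom \<Theta> B ?F"
      using homs(3) by (auto simp: gwo_hom_def hom_def simps sc Pi_iff)
    show "p \<circ> ?g \<in> gwo_hom \<Theta> ?F B"
      using homs(2) by (auto simp: gwo_hom_def hom_def simps g un bi Pi_iff)
    show "inj_on (f \<circ> i) (carrier A)"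
      using ii inj ic by (intro comp_inj_on) (auto intro: inj_on_subset)
    have "kernel ?F B (p \<circ> ?g) = f ` kernel E B p" by (auto simp: kernel_def simps g)
    then show "(f \<circ> i) ` carrier A = kernel ?F B (p \<circ> ?g)" by (metis image_comp ik)
    show "(p \<circ> ?g) ` carrier ?F = carrier B" using ps(1) by (simp add: simps image_image g)
    show "(p \<circ> ?g) ((f \<circ> s) b) = b" if "b \<in> carrier B" for b using that by (simp add: g sc ps)
  qed
  moreover have "actions_from \<Theta> A ?F B (f \<circ> i) (f \<circ> s) dot star"
    using act by (simp add: actions_from_def simps ic sc)
  ultimately show ?thesis unfolding derived_actions_def by blast
qed


section \<open>Crossed modules\<close>

definition crossed_module ::
    "('u, 'o) gwo_theory \<Rightarrow> ('a, 'u, 'o) gwo \<Rightarrow> ('b, 'u, 'o) gwo \<Rightarrow> ('a \<Rightarrow> 'b)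
      \<Rightarrow> ('b \<Rightarrow> 'a \<Rightarrow> 'a) \<Rightarrow> ('o \<Rightarrow> 'b \<Rightarrow> 'a \<Rightarrow> 'a) \<Rightarrow> bool" where
  "crossed_module \<Theta> A B \<alpha> dot star \<longleftrightarrow>
    gwo_object \<Theta> A \<and> gwo_object \<Theta> B \<and> derived_actions \<Theta> A B dot star \<and> \<alpha> \<in> gwo_hom \<Theta> A B \<and>
    (\<forall>b \<in> carrier B. \<forall>a \<in> carrier A. \<alpha> (dot b a) = b \<otimes>\<^bsub>B\<^esub> \<alpha> a \<otimes>\<^bsub>B\<^esub> inv\<^bsub>B\<^esub> b) \<and>
    (\<forall>a \<in> carrier A. \<forall>a' \<in> carrier A. dot (\<alpha> a) a' = a \<otimes>\<^bsub>A\<^esub> a' \<otimes>\<^bsub>A\<^esub> inv\<^bsub>A\<^esub> a) \<and>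
    (\<forall>m \<in> binops \<Theta>. \<forall>a \<in> carrier A. \<forall>a' \<in> carrier A. star m (\<alpha> a) a' = binary A m a a') \<and>
    (\<forall>m \<in> binops \<Theta>. \<forall>b \<in> carrier B. \<forall>a \<in> carrier A.
      \<alpha> (star m b a) = binary B m b (\<alpha> a) \<and>
      \<alpha> (star (opp \<Theta> m) b a) = binary B m (\<alpha> a) b)"
    \<comment> \<open>\<open>a \<star> b\<close> stands for \<open>b \<star>\<^sup>\<circ> a\<close>\<close>

text \<open>
  The action maps of \<open>T\<close> on \<open>S\<close> are those of \<open>B\<close> on \<open>A\<close>, of which only the values on
  \<open>T \<times> S\<close> matter.
\<close>

definition subcrossed_module ::
    "('u, 'o) gwo_theory \<Rightarrow> 'a set \<Rightarrow> 'b set \<Rightarrow> ('a \<Rightarrow> 'b) \<Rightarrow> ('a, 'u, 'o) gwo \<Rightarrow> ('b, 'u, 'o) gwo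
      \<Rightarrow> ('a \<Rightarrow> 'b) \<Rightarrow> ('b \<Rightarrow> 'a \<Rightarrow> 'a) \<Rightarrow> ('o \<Rightarrow> 'b \<Rightarrow> 'a \<Rightarrow> 'a) \<Rightarrow> bool" where
  "subcrossed_module \<Theta> S T \<sigma> A B \<alpha> dot star \<longleftrightarrow>
    gwo_subobject \<Theta> S A \<and> gwo_subobject \<Theta> T B \<and> (\<forall>s \<in> S. \<sigma> s = \<alpha> s) \<and>
    crossed_module \<Theta> (A\<lparr>carrier := S\<rparr>) (B\<lparr>carrier := T\<rparr>) \<sigma> dot star"

definition normal_subcrossed_module ::
    "('u, 'o) gwo_theory \<Rightarrow> 'a set \<Rightarrow> 'b set \<Rightarrow> ('a \<Rightarrow> 'b) \<Rightarrow> ('a, 'u, 'o) gwo \<Rightarrow> ('b, 'u, 'o) gwo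
      \<Rightarrow> ('a \<Rightarrow> 'b) \<Rightarrow> ('b \<Rightarrow> 'a \<Rightarrow> 'a) \<Rightarrow> ('o \<Rightarrow> 'b \<Rightarrow> 'a \<Rightarrow> 'a) \<Rightarrow> bool" where
  "normal_subcrossed_module \<Theta> S T \<sigma> A B \<alpha> dot star \<longleftrightarrow>
    subcrossed_module \<Theta> S T \<sigma> A B \<alpha> dot star \<and>
    gwo_ideal \<Theta> T B \<and>
    (\<forall>b \<in> carrier B. \<forall>s \<in> S. dot b s \<in> S) \<and>
    (\<forall>t \<in> T. \<forall>a \<in> carrier A. dot t a \<otimes>\<^bsub>A\<^esub> inv\<^bsub>A\<^esub> a \<in> S) \<and>
    (\<forall>m \<in> binops \<Theta>. \<forall>b \<in> carrier B. \<forall>s \<in> S. star m b s \<in> S) \<and>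
    (\<forall>m \<in> binops \<Theta>. \<forall>t \<in> T. \<forall>a \<in> carrier A. star m t a \<in> S)"

text \<open>As in \<open>gwo_quotient\<close>, induced maps are unions over all representatives.\<close>

definition quotient_map :: "('b, 'u, 'o) gwo \<Rightarrow> 'b set \<Rightarrow> ('a \<Rightarrow> 'b) \<Rightarrow> 'a set \<Rightarrow> 'b set" where
  "quotient_map B T \<alpha> X = (\<Union>x\<in>X. T #>\<^bsub>B\<^esub> \<alpha> x)"

definition quotient_action ::
    "('a, 'u, 'o) gwo \<Rightarrow> 'a set \<Rightarrow> ('b \<Rightarrow> 'a \<Rightarrow> 'a) \<Rightarrow> 'b set \<Rightarrow> 'a set \<Rightarrow> 'a set" where
  "quotient_action A S act Y X = (\<Union>b\<in>Y. \<Union>a\<in>X. S #>\<^bsub>A\<^esub> act b a)"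

end

theory Submission
  imports Defs
begin

text \<open>
  The two quotients are objects because a homomorphic image satisfies every identity of its source
  (\<open>gwo_object_hom_image\<close>), and (CM1)--(CM4) pass to classes once all induced maps are known to be
  computed on representatives. What has to be found is a split extension that realises the induced
  actions of \<open>B/T\<close> on \<open>A/S\<close>.

  Let \<open>A \<rightarrow> E \<rightarrow> B\<close>, with maps \<open>i\<close>, \<open>p\<close> and splitting \<open>s\<close>, realise the given actions. The subset
  \<open>N = i(S) + s(T)\<close> of \<open>E\<close> is an ideal. This is where all the normality conditions are used: expanding
  \<open>(i(a) + s(b)) \<star> (i(x) + s(t))\<close> by distributivity yields the four terms \<open>i(a \<star> x)\<close>, \<open>i(b \<star> x)\<close>,
  \<open>i(t \<star>\<^sup>\<circ> a)\<close> and \<open>s(b \<star> t)\<close>, and conjugating \<open>i(x) + s(t)\<close> by \<open>i(a)\<close> produces the correction term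
  \<open>a + t\<cdot>(-a)\<close>, a conjugate of \<open>t\<cdot>(-a) - (-a)\<close>. Moreover \<open>i\<^sup>-\<^sup>1(N) = S\<close> and \<open>p(N) = T\<close>, so that
  \<open>A/S \<rightarrow> E/N \<rightarrow> B/T\<close> is again a split extension (\<open>split_extension_quotient\<close>).

  That the induced actions are well defined needs no computation with representatives: in \<open>E\<close>
  they are conjugation and \<open>\<star>\<close>, which are compatible with the congruence modulo \<open>N\<close>, and \<open>A/S\<close>
  embeds in \<open>E/N\<close>. Finally, the crossed module is used to see that \<open>S\<close> is an ideal of \<open>A\<close>, since
  \<open>A\<close> acts on itself through \<open>\<alpha>\<close>, by (CM2) and (CM3).
\<close>


section \<open>Objects and morphisms\<close>

lemma gwo_object_group: "gwo_object \<Theta> A \<Longrightarrow> group A"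
  by (simp add: gwo_object_def)

lemma gwo_object_closed:
  assumes "gwo_object \<Theta> A"
  shows "\<And>w a. w \<in> unops \<Theta> \<Longrightarrow> a \<in> carrier A \<Longrightarrow> unary A w a \<in> carrier A"
    and "\<And>m a b. m \<in> binops \<Theta> \<Longrightarrow> a \<in> carrier A \<Longrightarrow> b \<in> carrier A \<Longrightarrow> binary A m a b \<in> carrier A"
  using assms by (simp_all add: gwo_object_def)

lemma gwo_object_ident:
  assumes "gwo_object \<Theta> A" "(l, r) \<in> idents \<Theta>" "range v \<subseteq> carrier A"
  shows "eval_gterm A v l = eval_gterm A v r"
  using assms unfolding gwo_object_def by blast

lemma unary_mult:
  assumes "groups_with_operations \<Theta>" "gwo_object \<Theta> A"
    and "a \<in> carrier A" "b \<in> carrier A" "w \<in> unops \<Theta>"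
  shows "unary A w (a \<otimes>\<^bsub>A\<^esub> b) = unary A w a \<otimes>\<^bsub>A\<^esub> unary A w b"
  using assms gwo_object_ident[OF assms(2), of "Unary w (Plus (Var 0) (Var 1))"
      "Plus (Unary w (Var 0)) (Unary w (Var 1))" "\<lambda>n. if n = 0 then a else b"]
  by (simp add: groups_with_operations_def image_subset_iff)

lemma binary_opp:
  assumes "groups_with_operations \<Theta>" "gwo_object \<Theta> A"
    and "a \<in> carrier A" "b \<in> carrier A" "m \<in> binops \<Theta>"
  shows "binary A (opp \<Theta> m) a b = binary A m b a"
  using assms gwo_object_ident[OF assms(2), of "Binary (opp \<Theta> m) (Var 0) (Var 1)"
      "Binary m (Var 1) (Var 0)" "\<lambda>n. if n = 0 then a else b"]
  by (simp add: groups_with_operations_def image_subset_iff)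

lemma binary_mult_right:
  assumes "groups_with_operations \<Theta>" "gwo_object \<Theta> A"
    and "a \<in> carrier A" "b \<in> carrier A" "c \<in> carrier A" "m \<in> binops \<Theta>"
  shows "binary A m a (b \<otimes>\<^bsub>A\<^esub> c) = binary A m a b \<otimes>\<^bsub>A\<^esub> binary A m a c"
  using assms gwo_object_ident[OF assms(2), of "Binary m (Var 0) (Plus (Var 1) (Var 2))"
      "Plus (Binary m (Var 0) (Var 1)) (Binary m (Var 0) (Var 2))"
      "\<lambda>n. if n = 0 then a else if n = 1 then b else c"]
  by (simp add: groups_with_operations_def image_subset_iff)

lemma opp_closed: "groups_with_operations \<Theta> \<Longrightarrow> m \<in> binops \<Theta> \<Longrightarrow> opp \<Theta> m \<in> binops \<Theta>"
  by (simp add: groups_with_operations_def)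

text \<open>Distributivity on the left is distributivity on the right of the opposite operation.\<close>

lemma binary_mult_left:
  assumes th: "groups_with_operations \<Theta>" and obj: "gwo_object \<Theta> A"
    and c: "a \<in> carrier A" "b \<in> carrier A" "c \<in> carrier A" and m: "m \<in> binops \<Theta>"
  shows "binary A m (a \<otimes>\<^bsub>A\<^esub> b) c = binary A m a c \<otimes>\<^bsub>A\<^esub> binary A m b c"
proof -
  interpret A: group A using obj by (rule gwo_object_group)
  have opp: "binary A m x c = binary A (opp \<Theta> m) c x" if "x \<in> carrier A" for x
    using binary_opp[OF th obj c(3) that m] by simp
  show ?thesis
    using binary_mult_right[OF th obj c(3,1,2) opp_closed[OF th m]] c by (simp add: opp)
qed

lemma gwo_hom_closed: "f \<in> gwo_hom \<Theta> A B \<Longrightarrow> a \<in> carrier A \<Longrightarrow> f a \<in> carrier B"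
  by (auto simp: gwo_hom_def hom_def)

lemma gwo_hom_mult:
  "f \<in> gwo_hom \<Theta> A B \<Longrightarrow> a \<in> carrier A \<Longrightarrow> a' \<in> carrier A \<Longrightarrow> f (a \<otimes>\<^bsub>A\<^esub> a') = f a \<otimes>\<^bsub>B\<^esub> f a'"
  by (auto simp: gwo_hom_def hom_def)

lemma gwo_hom_ops:
  assumes "f \<in> gwo_hom \<Theta> A B"
  shows "\<And>w a. w \<in> unops \<Theta> \<Longrightarrow> a \<in> carrier A \<Longrightarrow> f (unary A w a) = unary B w (f a)"
    and "\<And>m a a'. m \<in> binops \<Theta> \<Longrightarrow> a \<in> carrier A \<Longrightarrow> a' \<in> carrier A \<Longrightarrow>
      f (binary A m a a') = binary B m (f a) (f a')"
  using assms by (auto simp: gwo_hom_def)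

lemma gwo_hom_group_hom:
  assumes "group A" "group B" "f \<in> gwo_hom \<Theta> A B"
  shows "group_hom A B f"
  using assms by (simp add: group_hom_def group_hom_axioms_def gwo_hom_def)

lemma eval_gterm_hom:
  assumes obj: "gwo_object \<Theta> A" and "group B" and f: "f \<in> gwo_hom \<Theta> A B"
    and v: "range v \<subseteq> carrier A" and "unsyms t \<subseteq> unops \<Theta>" "binsyms t \<subseteq> binops \<Theta>"
  shows "eval_gterm B (\<lambda>n. f (v n)) t = f (eval_gterm A v t)"
proof -
  interpret f: group_hom A B f
    using assms by (intro gwo_hom_group_hom) (auto simp: gwo_object_group)
  show ?thesis
    using assms(5,6)
    by (induction t) (simp_all add: eval_gterm_closed[OF obj v] gwo_hom_ops[OF f])
qed

text \<open>
  Each assignment of values in the image lifts to one in the source, along which evaluation of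
  terms commutes with the homomorphism; so identities pass to the image.
\<close>

lemma gwo_object_hom_image:
  assumes th: "groups_with_operations \<Theta>" and obj: "gwo_object \<Theta> A" and B: "group B"
    and f: "f \<in> gwo_hom \<Theta> A B" and surj: "f ` carrier A = carrier B"
  shows "gwo_object \<Theta> B"
proof -
  have lift: "\<exists>a\<in>carrier A. f a = b" if "b \<in> carrier B" for b
    using that unfolding surj[symmetric] by auto
  have ident: "eval_gterm B v l = eval_gterm B v r"
    if lr: "(l, r) \<in> idents \<Theta>" and v: "range v \<subseteq> carrier B" for l r v
  proof -
    have "\<forall>n. \<exists>a\<in>carrier A. f a = v n" using v by (intro allI lift) auto
    then obtain u where u: "\<And>n. u n \<in> carrier A" "\<And>n. f (u n) = v n"
      using bchoice[of UNIV "\<lambda>n a. a \<in> carrier A \<and> f a = v n"] by auto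
    have syms: "unsyms l \<union> unsyms r \<subseteq> unops \<Theta>" "binsyms l \<union> binsyms r \<subseteq> binops \<Theta>"
      using th lr unfolding groups_with_operations_def by blast+
    have ru: "range u \<subseteq> carrier A" using u(1) by blast
    have ev: "eval_gterm B v t = f (eval_gterm A u t)"
      if "unsyms t \<subseteq> unops \<Theta>" "binsyms t \<subseteq> binops \<Theta>" for t
      using eval_gterm_hom[OF obj B f ru that] by (simp only: u(2))
    have "eval_gterm A u l = eval_gterm A u r" by (rule gwo_object_ident[OF obj lr ru])
    then show ?thesis using ev[of l] ev[of r] syms by simp
  qed
  have un: "unary B w b \<in> carrier B" if w: "w \<in> unops \<Theta>" and b: "b \<in> carrier B" for w b
  proof -
    obtain a where a: "a \<in> carrier A" "b = f a" using lift[OF b] by auto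
    then show ?thesis
      using gwo_hom_closed[OF f gwo_object_closed(1)[OF obj w a(1)]] gwo_hom_ops(1)[OF f w]
      by simp
  qed
  have bi: "binary B m b b' \<in> carrier B"
    if m: "m \<in> binops \<Theta>" and b: "b \<in> carrier B" "b' \<in> carrier B" for m b b'
  proof -
    obtain a a' where a: "a \<in> carrier A" "a' \<in> carrier A" "b = f a" "b' = f a'"
      using lift[OF b(1)] lift[OF b(2)] by auto
    then show ?thesis
      using gwo_hom_closed[OF f gwo_object_closed(2)[OF obj m a(1,2)]]
        gwo_hom_ops(2)[OF f m] by simp
  qed
  show ?thesis
    unfolding gwo_object_def using B un bi by (auto intro: ident)
qed


section \<open>Quotients by ideals\<close>

lemma (in group) r_coset_eq_iff:
  assumes "subgroup N G" "x \<in> carrier G" "y \<in> carrier G"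
  shows "N #> x = N #> y \<longleftrightarrow> x \<otimes> inv y \<in> N"
proof
  assume "N #> x = N #> y"
  then have "x \<in> N #> y" using rcos_self[OF assms(2,1)] by simp
  then show "x \<otimes> inv y \<in> N"
    using assms by (auto simp: r_coset_def m_assoc dest: subgroup.mem_carrier)
next
  assume h: "x \<otimes> inv y \<in> N"
  have "x = (x \<otimes> inv y) \<otimes> y" using assms by (simp add: m_assoc)
  then have "x \<in> N #> y" using h by (auto simp: r_coset_def)
  then show "N #> x = N #> y" using repr_independence assms by metis
qed

lemma (in group) r_coset_absorb:
  assumes "subgroup N G" "n \<in> N" "y \<in> carrier G"
  shows "N #> (n \<otimes> y) = N #> y"
proof -
  have "n \<in> carrier G" using assms(1,2) by (rule subgroup.mem_carrier)
  then show ?thesis using assms by (simp add: r_coset_eq_iff m_assoc)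
qed

lemma (in group) r_coset_memE:
  assumes "subgroup N G" "x \<in> N #> a" "a \<in> carrier G"
  shows "x \<in> carrier G" and "N #> x = N #> a"
proof -
  show x: "x \<in> carrier G"
    using assms by (auto simp: r_coset_def dest: subgroup.mem_carrier)
  show "N #> x = N #> a"
    using repr_independence[OF assms(2,3,1)] by simp
qed

lemma UN_eq_const:
  assumes "x \<in> X" and "\<And>x. x \<in> X \<Longrightarrow> F x = c"
  shows "(\<Union>x\<in>X. F x) = c"
  using assms by (intro SUP_eq_const) auto

lemma gwo_idealD:
  assumes "gwo_ideal \<Theta> N A"
  shows "N \<lhd> A" and "subgroup N A" and "N \<subseteq> carrier A"
    and "\<And>w n. w \<in> unops \<Theta> \<Longrightarrow> n \<in> N \<Longrightarrow> unary A w n \<in> N"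
    and "\<And>m a n. m \<in> binops \<Theta> \<Longrightarrow> a \<in> carrier A \<Longrightarrow> n \<in> N \<Longrightarrow> binary A m a n \<in> N"
  using assms subgroup.subset by (auto simp: gwo_ideal_def gwo_subobject_def)

lemma gwo_ideal_absorb_left:
  assumes th: "groups_with_operations \<Theta>" and obj: "gwo_object \<Theta> A" and N: "gwo_ideal \<Theta> N A"
    and "m \<in> binops \<Theta>" "n \<in> N" "a \<in> carrier A"
  shows "binary A m n a \<in> N"
  using assms gwo_idealD[OF N] binary_opp[OF th obj, of a n m] opp_closed[OF th]
  by (metis subsetD)

text \<open>Together with additivity, absorption on either side makes the operations respect cosets.\<close>

lemma gwo_quotient_coset:
  assumes th: "groups_with_operations \<Theta>" and obj: "gwo_object \<Theta> A" and N: "gwo_ideal \<Theta> N A"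
  shows "\<And>a b. a \<in> carrier A \<Longrightarrow> b \<in> carrier A \<Longrightarrow>
      (N #>\<^bsub>A\<^esub> a) \<otimes>\<^bsub>gwo_quotient A N\<^esub> (N #>\<^bsub>A\<^esub> b) = N #>\<^bsub>A\<^esub> (a \<otimes>\<^bsub>A\<^esub> b)"
    and "\<And>w a. w \<in> unops \<Theta> \<Longrightarrow> a \<in> carrier A \<Longrightarrow>
      unary (gwo_quotient A N) w (N #>\<^bsub>A\<^esub> a) = N #>\<^bsub>A\<^esub> unary A w a"
    and "\<And>m a b. m \<in> binops \<Theta> \<Longrightarrow> a \<in> carrier A \<Longrightarrow> b \<in> carrier A \<Longrightarrow>
      binary (gwo_quotient A N) m (N #>\<^bsub>A\<^esub> a) (N #>\<^bsub>A\<^esub> b) = N #>\<^bsub>A\<^esub> binary A m a b"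
proof -
  interpret A: group A using obj by (rule gwo_object_group)
  note N' = gwo_idealD[OF N]
  note cl = gwo_object_closed[OF obj]
  have rep: "\<exists>n\<in>N. x = n \<otimes>\<^bsub>A\<^esub> c" if "x \<in> N #>\<^bsub>A\<^esub> c" for x c
    using that by (auto simp: r_coset_def)
  have self: "c \<in> N #>\<^bsub>A\<^esub> c" if "c \<in> carrier A" for c using A.rcos_self[OF that N'(2)] .
  show "(N #>\<^bsub>A\<^esub> a) \<otimes>\<^bsub>gwo_quotient A N\<^esub> (N #>\<^bsub>A\<^esub> b) = N #>\<^bsub>A\<^esub> (a \<otimes>\<^bsub>A\<^esub> b)"
    if a: "a \<in> carrier A" and b: "b \<in> carrier A" for a b
    using normal.rcos_sum[OF N'(1) a b] by (simp add: gwo_quotient_def FactGroup_def)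
  show "unary (gwo_quotient A N) w (N #>\<^bsub>A\<^esub> a) = N #>\<^bsub>A\<^esub> unary A w a"
    if w: "w \<in> unops \<Theta>" and a: "a \<in> carrier A" for w a
  proof -
    have eq: "N #>\<^bsub>A\<^esub> unary A w x = N #>\<^bsub>A\<^esub> unary A w a" if x: "x \<in> N #>\<^bsub>A\<^esub> a" for x
    proof -
      obtain n where n: "n \<in> N" "x = n \<otimes>\<^bsub>A\<^esub> a" using rep[OF x] by blast
      then have "unary A w x = unary A w n \<otimes>\<^bsub>A\<^esub> unary A w a"
        using unary_mult[OF th obj _ a w] N'(3) by blast
      then show ?thesis using A.r_coset_absorb[OF N'(2)] N'(4)[OF w n(1)] cl(1)[OF w a] by simp
    qed
    show ?thesis using UN_eq_const[OF self[OF a] eq] by (simp add: gwo_quotient_def)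
  qed
  show "binary (gwo_quotient A N) m (N #>\<^bsub>A\<^esub> a) (N #>\<^bsub>A\<^esub> b) = N #>\<^bsub>A\<^esub> binary A m a b"
    if m: "m \<in> binops \<Theta>" and a: "a \<in> carrier A" and b: "b \<in> carrier A" for m a b
  proof -
    have eq: "N #>\<^bsub>A\<^esub> binary A m x y = N #>\<^bsub>A\<^esub> binary A m a b"
      if x: "x \<in> N #>\<^bsub>A\<^esub> a" and y: "y \<in> N #>\<^bsub>A\<^esub> b" for x y
    proof -
      obtain n where n: "n \<in> N" "x = n \<otimes>\<^bsub>A\<^esub> a" using rep[OF x] by blast
      obtain k where k: "k \<in> N" "y = k \<otimes>\<^bsub>A\<^esub> b" using rep[OF y] by blast
      have nk: "n \<in> carrier A" "k \<in> carrier A" using n k N'(3) by auto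
      have xc: "x \<in> carrier A" using nk a n by simp
      have "binary A m x y = binary A m x k \<otimes>\<^bsub>A\<^esub> binary A m x b"
        using binary_mult_right[OF th obj xc nk(2) b m] k by simp
      moreover have "binary A m x b = binary A m n b \<otimes>\<^bsub>A\<^esub> binary A m a b"
        using binary_mult_left[OF th obj nk(1) a b m] n by simp
      ultimately show ?thesis
        using A.r_coset_absorb[OF N'(2)] N'(5)[OF m xc k(1)] cl(2)[OF m a b] cl(2)[OF m nk(1) b]
          gwo_ideal_absorb_left[OF th obj N m n(1) b] by simp
    qed
    show ?thesis
      using UN_eq_const[OF self[OF a] UN_eq_const[OF self[OF b] eq]] by (simp add: gwo_quotient_def)
  qed
qed

lemma carrier_gwo_quotient: "carrier (gwo_quotient A N) = (\<lambda>a. N #>\<^bsub>A\<^esub> a) ` carrier A"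
  by (auto simp: gwo_quotient_def FactGroup_def RCOSETS_def)

lemma gwo_quotient_group:
  assumes "N \<lhd> A"
  shows "group (gwo_quotient A N)"
proof -
  interpret Q: group "A Mod N" using assms by (rule normal.factorgroup_is_group)
  show ?thesis
    using Q.m_assoc Q.l_inv_ex Q.m_closed Q.one_closed Q.l_one
    by (intro groupI) (simp_all add: gwo_quotient_def)
qed

lemma gwo_quotient_proj_hom:
  assumes "groups_with_operations \<Theta>" "gwo_object \<Theta> A" "gwo_ideal \<Theta> N A"
  shows "(\<lambda>a. N #>\<^bsub>A\<^esub> a) \<in> gwo_hom \<Theta> A (gwo_quotient A N)"
  using gwo_quotient_coset[OF assms] by (auto simp: gwo_hom_def hom_def carrier_gwo_quotient)

lemma gwo_quotient_object:
  assumes "groups_with_operations \<Theta>" "gwo_object \<Theta> A" "gwo_ideal \<Theta> N A"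
  shows "gwo_object \<Theta> (gwo_quotient A N)"
  using assms gwo_idealD(1)[OF assms(3)]
  by (intro gwo_object_hom_image[OF _ _ _ gwo_quotient_proj_hom])
    (auto simp: carrier_gwo_quotient gwo_quotient_group)

lemma gwo_quotient_inv:
  assumes "groups_with_operations \<Theta>" "gwo_object \<Theta> A" "gwo_ideal \<Theta> N A" "a \<in> carrier A"
  shows "inv\<^bsub>gwo_quotient A N\<^esub> (N #>\<^bsub>A\<^esub> a) = N #>\<^bsub>A\<^esub> inv\<^bsub>A\<^esub> a"
proof -
  interpret group_hom A "gwo_quotient A N" "\<lambda>a. N #>\<^bsub>A\<^esub> a"
    using assms
    by (intro gwo_hom_group_hom[OF _ _ gwo_quotient_proj_hom])
      (auto intro: gwo_object_group gwo_quotient_object)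
  show ?thesis using assms(4) by simp
qed

lemma one_gwo_quotient: "\<one>\<^bsub>gwo_quotient A N\<^esub> = N"
  by (simp add: gwo_quotient_def FactGroup_def)

lemma quotient_map_coset:
  assumes "group A" "group B" and f: "f \<in> gwo_hom \<Theta> A B" and "subgroup S A" "subgroup T B"
    and sub: "f ` S \<subseteq> T" and a: "a \<in> carrier A"
  shows "quotient_map B T f (S #>\<^bsub>A\<^esub> a) = T #>\<^bsub>B\<^esub> f a"
proof -
  interpret A: group A by fact
  interpret B: group B by fact
  have eq: "T #>\<^bsub>B\<^esub> f x = T #>\<^bsub>B\<^esub> f a" if x: "x \<in> S #>\<^bsub>A\<^esub> a" for x
  proof -
    obtain n where n: "n \<in> S" "x = n \<otimes>\<^bsub>A\<^esub> a" using x by (auto simp: r_coset_def)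
    then have "f x = f n \<otimes>\<^bsub>B\<^esub> f a"
      using gwo_hom_mult[OF f _ a] subgroup.mem_carrier[OF assms(4)] by blast
    moreover have "f n \<in> T" using sub n(1) by blast
    ultimately show ?thesis
      using B.r_coset_absorb[OF assms(5)] gwo_hom_closed[OF f a] by simp
  qed
  show ?thesis
    unfolding quotient_map_def using A.rcos_self[OF a assms(4)] eq by (rule UN_eq_const)
qed

lemma quotient_map_hom:
  assumes th: "groups_with_operations \<Theta>" and A: "gwo_object \<Theta> A" and B: "gwo_object \<Theta> B"
    and S: "gwo_ideal \<Theta> S A" and T: "gwo_ideal \<Theta> T B"
    and f: "f \<in> gwo_hom \<Theta> A B" and sub: "f ` S \<subseteq> T"
  shows "quotient_map B T f \<in> gwo_hom \<Theta> (gwo_quotient A S) (gwo_quotient B T)"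
proof -
  interpret A: group A using A by (rule gwo_object_group)
  interpret B: group B using B by (rule gwo_object_group)
  have qm: "quotient_map B T f (S #>\<^bsub>A\<^esub> a) = T #>\<^bsub>B\<^esub> f a" if "a \<in> carrier A" for a
    using quotient_map_coset[OF A.group_axioms B.group_axioms f gwo_idealD(2)[OF S]
        gwo_idealD(2)[OF T] sub that] .
  show ?thesis
    using gwo_object_closed[OF A]
    by (auto simp: gwo_hom_def hom_def carrier_gwo_quotient qm gwo_hom_closed[OF f]
        gwo_quotient_coset[OF th A S] gwo_quotient_coset[OF th B T] gwo_hom_mult[OF f]
        gwo_hom_ops[OF f])
qed


section \<open>Quotients of split extensions\<close>

text \<open>
  The hypotheses on \<open>S\<close> and \<open>T\<close> say that the actions descend to actions of \<open>B/T\<close> on \<open>A/S\<close>: \<open>B\<close>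
  preserves \<open>S\<close>, and \<open>T\<close> acts trivially on \<open>A\<close> modulo \<open>S\<close> (by the identity for the dot action, by
  zero for the actions \<open>\<star>\<close>).
\<close>

locale split_extension_ideals =
  fixes \<Theta> :: "('u, 'o) gwo_theory"
    and A :: "('a, 'u, 'o) gwo" and E :: "('e, 'u, 'o) gwo" and B :: "('b, 'u, 'o) gwo"
    and i :: "'a \<Rightarrow> 'e" and p :: "'e \<Rightarrow> 'b" and s :: "'b \<Rightarrow> 'e"
    and dot :: "'b \<Rightarrow> 'a \<Rightarrow> 'a" and star :: "'o \<Rightarrow> 'b \<Rightarrow> 'a \<Rightarrow> 'a"
    and S :: "'a set" and T :: "'b set"
  assumes th: "groups_with_operations \<Theta>"
    and ext: "split_extension \<Theta> A E B i p s"
    and act: "actions_from \<Theta> A E B i s dot star"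
    and S: "gwo_ideal \<Theta> S A" and T: "gwo_ideal \<Theta> T B"
    and dot_S: "\<And>b x. b \<in> carrier B \<Longrightarrow> x \<in> S \<Longrightarrow> dot b x \<in> S"
    and dot_T: "\<And>t a. t \<in> T \<Longrightarrow> a \<in> carrier A \<Longrightarrow> dot t a \<otimes>\<^bsub>A\<^esub> inv\<^bsub>A\<^esub> a \<in> S"
    and star_S: "\<And>m b x. m \<in> binops \<Theta> \<Longrightarrow> b \<in> carrier B \<Longrightarrow> x \<in> S \<Longrightarrow> star m b x \<in> S"
    and star_T: "\<And>m t a. m \<in> binops \<Theta> \<Longrightarrow> t \<in> T \<Longrightarrow> a \<in> carrier A \<Longrightarrow> star m t a \<in> S"
begin

lemma objects: "gwo_object \<Theta> A" "gwo_object \<Theta> E" "gwo_object \<Theta> B"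
  and homs: "i \<in> gwo_hom \<Theta> A E" "p \<in> gwo_hom \<Theta> E B" "s \<in> gwo_hom \<Theta> B E"
  and inj: "inj_on i (carrier A)" and i_image: "i ` carrier A = kernel E B p"
  and p_surj: "p ` carrier E = carrier B" and p_s [simp]: "b \<in> carrier B \<Longrightarrow> p (s b) = b"
  using ext by (auto simp: split_extension_def)

sublocale A: group A using objects(1) by (rule gwo_object_group)
sublocale E: group E using objects(2) by (rule gwo_object_group)
sublocale B: group B using objects(3) by (rule gwo_object_group)
sublocale i: group_hom A E i using homs by (intro gwo_hom_group_hom) unfold_locales
sublocale p: group_hom E B p using homs by (intro gwo_hom_group_hom) unfold_locales
sublocale s: group_hom B E s using homs by (intro gwo_hom_group_hom) unfold_locales
sublocale S: subgroup S A using gwo_idealD[OF S] by blast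
sublocale T: subgroup T B using gwo_idealD[OF T] by blast

lemma p_i [simp]: "a \<in> carrier A \<Longrightarrow> p (i a) = \<one>\<^bsub>B\<^esub>"
  using i_image by (auto simp: kernel_def)

lemma action_closed:
  "b \<in> carrier B \<Longrightarrow> a \<in> carrier A \<Longrightarrow> dot b a \<in> carrier A"
  "m \<in> binops \<Theta> \<Longrightarrow> b \<in> carrier B \<Longrightarrow> a \<in> carrier A \<Longrightarrow> star m b a \<in> carrier A"
  using act by (auto simp: actions_from_def)

lemma i_action:
  "b \<in> carrier B \<Longrightarrow> a \<in> carrier A \<Longrightarrow> i (dot b a) = s b \<otimes>\<^bsub>E\<^esub> i a \<otimes>\<^bsub>E\<^esub> inv\<^bsub>E\<^esub> (s b)"
  "m \<in> binops \<Theta> \<Longrightarrow> b \<in> carrier B \<Longrightarrow> a \<in> carrier A \<Longrightarrow> i (star m b a) = binary E m (s b) (i a)"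
  using act by (auto simp: actions_from_def)

lemma decompose:
  assumes e: "e \<in> carrier E"
  obtains a where "a \<in> carrier A" "e = i a \<otimes>\<^bsub>E\<^esub> s (p e)"
proof -
  have "e \<otimes>\<^bsub>E\<^esub> inv\<^bsub>E\<^esub> (s (p e)) \<in> kernel E B p" using e by (simp add: kernel_def)
  then obtain a where a: "a \<in> carrier A" "i a = e \<otimes>\<^bsub>E\<^esub> inv\<^bsub>E\<^esub> (s (p e))"
    using i_image by (metis imageE)
  then have "e = i a \<otimes>\<^bsub>E\<^esub> s (p e)" using e by (simp add: E.m_assoc)
  with a(1) show thesis by (rule that)
qed

definition N :: "'e set" where
  "N = (\<lambda>(x, t). i x \<otimes>\<^bsub>E\<^esub> s t) ` (S \<times> T)"

lemma N_I: "x \<in> S \<Longrightarrow> t \<in> T \<Longrightarrow> i x \<otimes>\<^bsub>E\<^esub> s t \<in> N"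
  by (auto simp: N_def)

lemma N_E:
  assumes "n \<in> N"
  obtains x t where "x \<in> S" "t \<in> T" "n = i x \<otimes>\<^bsub>E\<^esub> s t"
  using assms by (auto simp: N_def)

lemma i_in_N: "x \<in> S \<Longrightarrow> i x \<in> N"
  using N_I[of x "\<one>\<^bsub>B\<^esub>"] by simp

lemma s_in_N: "t \<in> T \<Longrightarrow> s t \<in> N"
  using N_I[of "\<one>\<^bsub>A\<^esub>" t] by simp

lemma s_i_swap: "b \<in> carrier B \<Longrightarrow> a \<in> carrier A \<Longrightarrow> s b \<otimes>\<^bsub>E\<^esub> i a = i (dot b a) \<otimes>\<^bsub>E\<^esub> s b"
  by (simp add: i_action E.m_assoc)

lemma N_subgroup: "subgroup N E"
proof (rule E.subgroupI)
  show "N \<subseteq> carrier E" by (auto simp: N_def)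
  show "N \<noteq> {}" using i_in_N[OF S.one_closed] by auto
  show "inv\<^bsub>E\<^esub> n \<in> N" if n: "n \<in> N" for n
  proof -
    obtain x t where xt: "x \<in> S" "t \<in> T" "n = i x \<otimes>\<^bsub>E\<^esub> s t" using N_E[OF n] .
    then have "inv\<^bsub>E\<^esub> n = s (inv\<^bsub>B\<^esub> t) \<otimes>\<^bsub>E\<^esub> i (inv\<^bsub>A\<^esub> x)" by (simp add: E.inv_mult_group)
    also have "\<dots> = i (dot (inv\<^bsub>B\<^esub> t) (inv\<^bsub>A\<^esub> x)) \<otimes>\<^bsub>E\<^esub> s (inv\<^bsub>B\<^esub> t)"
      using xt by (intro s_i_swap) auto
    finally have "inv\<^bsub>E\<^esub> n = i (dot (inv\<^bsub>B\<^esub> t) (inv\<^bsub>A\<^esub> x)) \<otimes>\<^bsub>E\<^esub> s (inv\<^bsub>B\<^esub> t)" .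
    moreover have "dot (inv\<^bsub>B\<^esub> t) (inv\<^bsub>A\<^esub> x) \<in> S" using xt by (intro dot_S) auto
    ultimately show ?thesis using N_I T.m_inv_closed[OF xt(2)] by metis
  qed
  show "n \<otimes>\<^bsub>E\<^esub> k \<in> N" if n: "n \<in> N" and k: "k \<in> N" for n k
  proof -
    obtain x t where xt: "x \<in> S" "t \<in> T" "n = i x \<otimes>\<^bsub>E\<^esub> s t" using N_E[OF n] .
    obtain y u where yu: "y \<in> S" "u \<in> T" "k = i y \<otimes>\<^bsub>E\<^esub> s u" using N_E[OF k] .
    have d: "dot t y \<in> S" using xt yu by (simp add: dot_S)
    have "n \<otimes>\<^bsub>E\<^esub> k = i x \<otimes>\<^bsub>E\<^esub> (s t \<otimes>\<^bsub>E\<^esub> i y) \<otimes>\<^bsub>E\<^esub> s u" using xt yu by (simp add: E.m_assoc)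
    also have "\<dots> = i (x \<otimes>\<^bsub>A\<^esub> dot t y) \<otimes>\<^bsub>E\<^esub> s (t \<otimes>\<^bsub>B\<^esub> u)"
      using xt yu d by (simp add: s_i_swap E.m_assoc)
    finally have "n \<otimes>\<^bsub>E\<^esub> k = i (x \<otimes>\<^bsub>A\<^esub> dot t y) \<otimes>\<^bsub>E\<^esub> s (t \<otimes>\<^bsub>B\<^esub> u)" .
    moreover have "x \<otimes>\<^bsub>A\<^esub> dot t y \<in> S" "t \<otimes>\<^bsub>B\<^esub> u \<in> T" using xt yu d by auto
    ultimately show ?thesis using N_I by metis
  qed
qed

sublocale N: subgroup N E by (rule N_subgroup)

text \<open>
  Moving \<open>s(t)\<close> past \<open>i(-a)\<close> turns the conjugate into \<open>i(a + x + t\<cdot>(-a)) + s(t)\<close>. Its first argument is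
  \<open>(a + x - a) + (a + (t\<cdot>(-a) + a) - a)\<close>, a sum of conjugates of elements of \<open>S\<close>, since \<open>t\<close> moves
  \<open>-a\<close> only by an element of \<open>S\<close>.
\<close>

lemma conj_i_in_N:
  assumes a: "a \<in> carrier A" and x: "x \<in> S" and t: "t \<in> T"
  shows "i a \<otimes>\<^bsub>E\<^esub> (i x \<otimes>\<^bsub>E\<^esub> s t) \<otimes>\<^bsub>E\<^esub> inv\<^bsub>E\<^esub> (i a) \<in> N"
proof -
  let ?d = "dot t (inv\<^bsub>A\<^esub> a)"
  have nS: "S \<lhd> A" using gwo_idealD[OF S] by blast
  have d: "?d \<in> carrier A" using a t by (simp add: action_closed)
  have "?d \<otimes>\<^bsub>A\<^esub> a \<in> S" using dot_T[OF t, of "inv\<^bsub>A\<^esub> a"] a by simp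
  then have "(a \<otimes>\<^bsub>A\<^esub> x \<otimes>\<^bsub>A\<^esub> inv\<^bsub>A\<^esub> a) \<otimes>\<^bsub>A\<^esub> (a \<otimes>\<^bsub>A\<^esub> (?d \<otimes>\<^bsub>A\<^esub> a) \<otimes>\<^bsub>A\<^esub> inv\<^bsub>A\<^esub> a) \<in> S"
    using normal.inv_op_closed2[OF nS a] x by blast
  also have "(a \<otimes>\<^bsub>A\<^esub> x \<otimes>\<^bsub>A\<^esub> inv\<^bsub>A\<^esub> a) \<otimes>\<^bsub>A\<^esub> (a \<otimes>\<^bsub>A\<^esub> (?d \<otimes>\<^bsub>A\<^esub> a) \<otimes>\<^bsub>A\<^esub> inv\<^bsub>A\<^esub> a) = a \<otimes>\<^bsub>A\<^esub> x \<otimes>\<^bsub>A\<^esub> ?d"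
    using a x d by (simp add: A.m_assoc A.inv_solve_left A.l_inv)
       (simp flip: A.m_assoc)
  finally have "i (a \<otimes>\<^bsub>A\<^esub> x \<otimes>\<^bsub>A\<^esub> ?d) \<otimes>\<^bsub>E\<^esub> s t \<in> N" using t by (rule N_I)
  also have "i (a \<otimes>\<^bsub>A\<^esub> x \<otimes>\<^bsub>A\<^esub> ?d) \<otimes>\<^bsub>E\<^esub> s t = i a \<otimes>\<^bsub>E\<^esub> i x \<otimes>\<^bsub>E\<^esub> (i ?d \<otimes>\<^bsub>E\<^esub> s t)"
    using a x t d by (simp add: E.m_assoc)
  also have "i ?d \<otimes>\<^bsub>E\<^esub> s t = s t \<otimes>\<^bsub>E\<^esub> inv\<^bsub>E\<^esub> (i a)"
    using a t s_i_swap[of t "inv\<^bsub>A\<^esub> a"] by simp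
  finally show ?thesis using a x t by (simp add: E.m_assoc)
qed

lemma conj_s_in_N:
  assumes b: "b \<in> carrier B" and x: "x \<in> S" and t: "t \<in> T"
  shows "s b \<otimes>\<^bsub>E\<^esub> (i x \<otimes>\<^bsub>E\<^esub> s t) \<otimes>\<^bsub>E\<^esub> inv\<^bsub>E\<^esub> (s b) \<in> N"
proof -
  have "b \<otimes>\<^bsub>B\<^esub> t \<otimes>\<^bsub>B\<^esub> inv\<^bsub>B\<^esub> b \<in> T"
    using normal.inv_op_closed2[OF gwo_idealD(1)[OF T] b t] .
  then have "i (dot b x) \<otimes>\<^bsub>E\<^esub> s (b \<otimes>\<^bsub>B\<^esub> t \<otimes>\<^bsub>B\<^esub> inv\<^bsub>B\<^esub> b) \<in> N" using b x by (intro N_I dot_S)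
  also have "i (dot b x) \<otimes>\<^bsub>E\<^esub> s (b \<otimes>\<^bsub>B\<^esub> t \<otimes>\<^bsub>B\<^esub> inv\<^bsub>B\<^esub> b)
      = (i (dot b x) \<otimes>\<^bsub>E\<^esub> s b) \<otimes>\<^bsub>E\<^esub> s t \<otimes>\<^bsub>E\<^esub> inv\<^bsub>E\<^esub> (s b)"
    using b x t by (simp add: E.m_assoc action_closed)
  also have "i (dot b x) \<otimes>\<^bsub>E\<^esub> s b = s b \<otimes>\<^bsub>E\<^esub> i x" using b x by (simp add: s_i_swap)
  finally show ?thesis using b x t by (simp add: E.m_assoc)
qed

text \<open>\<open>E\<close> is generated by \<open>i(A)\<close> and \<open>s(B)\<close>, so conjugation by these suffices.\<close>

lemma N_normal: "N \<lhd> E"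
proof -
  have "e \<otimes>\<^bsub>E\<^esub> n \<otimes>\<^bsub>E\<^esub> inv\<^bsub>E\<^esub> e \<in> N" if e: "e \<in> carrier E" and n: "n \<in> N" for e n
  proof -
    obtain a where a: "a \<in> carrier A" "e = i a \<otimes>\<^bsub>E\<^esub> s (p e)" using decompose[OF e] .
    let ?b = "p e"
    have "s ?b \<otimes>\<^bsub>E\<^esub> n \<otimes>\<^bsub>E\<^esub> inv\<^bsub>E\<^esub> (s ?b) \<in> N"
      using N_E[OF n] conj_s_in_N[OF p.hom_closed[OF e]] by metis
    then have "i a \<otimes>\<^bsub>E\<^esub> (s ?b \<otimes>\<^bsub>E\<^esub> n \<otimes>\<^bsub>E\<^esub> inv\<^bsub>E\<^esub> (s ?b)) \<otimes>\<^bsub>E\<^esub> inv\<^bsub>E\<^esub> (i a) \<in> N"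
      using N_E conj_i_in_N[OF a(1)] by metis
    also have "i a \<otimes>\<^bsub>E\<^esub> (s ?b \<otimes>\<^bsub>E\<^esub> n \<otimes>\<^bsub>E\<^esub> inv\<^bsub>E\<^esub> (s ?b)) \<otimes>\<^bsub>E\<^esub> inv\<^bsub>E\<^esub> (i a)
        = (i a \<otimes>\<^bsub>E\<^esub> s ?b) \<otimes>\<^bsub>E\<^esub> n \<otimes>\<^bsub>E\<^esub> inv\<^bsub>E\<^esub> (i a \<otimes>\<^bsub>E\<^esub> s ?b)"
      using a(1) n e by (simp add: E.m_assoc E.inv_mult_group)
    finally show ?thesis using a(2) by simp
  qed
  then show ?thesis using N_subgroup E.normal_inv_iff by blast
qed

text \<open>
  Of the four terms obtained by distributivity, \<open>i(a) \<star> s(t)\<close> is the only one that is not directly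
  an operation in \<open>A\<close> or \<open>B\<close> or an action of \<open>B\<close>; it is the action of \<open>t\<close> on \<open>a\<close> by the opposite
  operation.
\<close>

lemma N_absorbs:
  assumes m: "m \<in> binops \<Theta>" and e: "e \<in> carrier E" and n: "n \<in> N"
  shows "binary E m e n \<in> N"
proof -
  note mult = binary_mult_right[OF th objects(2)] binary_mult_left[OF th objects(2)]
  obtain a where a: "a \<in> carrier A" "e = i a \<otimes>\<^bsub>E\<^esub> s (p e)" using decompose[OF e] .
  define b where "b = p e"
  have b: "b \<in> carrier B" using e by (simp add: b_def)
  obtain x t where xt: "x \<in> S" "t \<in> T" "n = i x \<otimes>\<^bsub>E\<^esub> s t" using N_E[OF n] .
  have aa: "binary E m (i a) (i x) \<in> N"
    using gwo_idealD(5)[OF S m a(1) xt(1)] gwo_hom_ops(2)[OF homs(1) m a(1), of x] xt(1)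
    by (metis S.mem_carrier i_in_N)
  have ba: "binary E m (s b) (i x) \<in> N"
    using i_in_N[OF star_S[OF m b xt(1)]] i_action(2)[OF m b] xt(1) by simp
  have "binary E m (i a) (s t) = i (star (opp \<Theta> m) t a)"
    using i_action(2)[OF opp_closed[OF th m], of t a] a xt
      binary_opp[OF th objects(2), of "s t" "i a" m] m by simp
  then have ab: "binary E m (i a) (s t) \<in> N"
    using i_in_N[OF star_T[OF opp_closed[OF th m] xt(2) a(1)]] by simp
  have bb: "binary E m (s b) (s t) \<in> N"
    using gwo_idealD(5)[OF T m b xt(2)] gwo_hom_ops(2)[OF homs(3) m b, of t] xt(2)
    by (metis T.mem_carrier s_in_N)
  have "binary E m e n = binary E m (i a \<otimes>\<^bsub>E\<^esub> s b) (i x) \<otimes>\<^bsub>E\<^esub> binary E m (i a \<otimes>\<^bsub>E\<^esub> s b) (s t)"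
    using a b xt m by (simp add: mult(1) flip: b_def)
  also have "\<dots> \<in> N" using a b xt m aa ba ab bb by (simp add: mult(2))
  finally show ?thesis .
qed

lemma N_ideal: "gwo_ideal \<Theta> N E"
proof -
  have "unary E w n \<in> N" if w: "w \<in> unops \<Theta>" and n: "n \<in> N" for w n
  proof -
    obtain x t where xt: "x \<in> S" "t \<in> T" "n = i x \<otimes>\<^bsub>E\<^esub> s t" using N_E[OF n] .
    have "unary E w n = i (unary A w x) \<otimes>\<^bsub>E\<^esub> s (unary B w t)"
      using xt w unary_mult[OF th objects(2), of "i x" "s t" w]
      by (simp add: gwo_hom_ops[OF homs(1)] gwo_hom_ops[OF homs(3)])
    then show ?thesis using N_I gwo_idealD(4)[OF S w] gwo_idealD(4)[OF T w] xt by simp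
  qed
  then show ?thesis
    using N_subgroup N_normal N_absorbs N.mem_carrier
    by (auto simp: gwo_ideal_def gwo_subobject_def)
qed

lemma i_in_N_iff: "a \<in> carrier A \<Longrightarrow> i a \<in> N \<longleftrightarrow> a \<in> S"
proof
  assume a: "a \<in> carrier A" and "i a \<in> N"
  then obtain x t where xt: "x \<in> S" "t \<in> T" "i a = i x \<otimes>\<^bsub>E\<^esub> s t" using N_E by blast
  \<comment> \<open>applying \<open>p\<close> kills both \<open>i\<close>-terms\<close>
  have "p (i a) = t" using xt by simp
  then have "t = \<one>\<^bsub>B\<^esub>" using a by simp
  then have "i a = i x" using xt by simp
  then show "a \<in> S" using inj a xt(1) by (metis inj_onD S.mem_carrier)
qed (simp add: i_in_N)

lemma coset_N_i_eq_iff: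
  assumes "a \<in> carrier A" "a' \<in> carrier A"
  shows "N #>\<^bsub>E\<^esub> i a = N #>\<^bsub>E\<^esub> i a' \<longleftrightarrow> S #>\<^bsub>A\<^esub> a = S #>\<^bsub>A\<^esub> a'"
  using i_in_N_iff[of "a \<otimes>\<^bsub>A\<^esub> inv\<^bsub>A\<^esub> a'"] assms
  by (simp add: E.r_coset_eq_iff[OF N_subgroup] A.r_coset_eq_iff[OF S.subgroup_axioms])

lemma p_N: "p ` N \<subseteq> T"
  by (auto elim!: N_E)

lemma i_S: "i ` S \<subseteq> N" and s_T: "s ` T \<subseteq> N"
  by (auto simp: i_in_N s_in_N)

lemma induced_coset:
  "a \<in> carrier A \<Longrightarrow> quotient_map E N i (S #>\<^bsub>A\<^esub> a) = N #>\<^bsub>E\<^esub> i a"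
  "e \<in> carrier E \<Longrightarrow> quotient_map B T p (N #>\<^bsub>E\<^esub> e) = T #>\<^bsub>B\<^esub> p e"
  "b \<in> carrier B \<Longrightarrow> quotient_map E N s (T #>\<^bsub>B\<^esub> b) = N #>\<^bsub>E\<^esub> s b"
  using quotient_map_coset[OF A.group_axioms E.group_axioms homs(1) S.subgroup_axioms N_subgroup i_S]
    quotient_map_coset[OF E.group_axioms B.group_axioms homs(2) N_subgroup T.subgroup_axioms p_N]
    quotient_map_coset[OF B.group_axioms E.group_axioms homs(3) T.subgroup_axioms N_subgroup s_T]
  by auto

text \<open>
  The kernel of \<open>E/N \<rightarrow> B/T\<close> consists of the classes of \<open>e\<close> with \<open>p(e) \<in> T\<close>; writing
  \<open>e = i(a) + s(p(e))\<close>, such an \<open>e\<close> is congruent to \<open>i(a)\<close> modulo \<open>N\<close>.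
\<close>

lemma split_extension_quotient:
  "split_extension \<Theta> (gwo_quotient A S) (gwo_quotient E N) (gwo_quotient B T)
     (quotient_map E N i) (quotient_map B T p) (quotient_map E N s)"
  unfolding split_extension_def
proof (intro conjI ballI)
  show "gwo_object \<Theta> (gwo_quotient A S)" "gwo_object \<Theta> (gwo_quotient E N)"
    "gwo_object \<Theta> (gwo_quotient B T)"
    using objects S T N_ideal by (auto intro: gwo_quotient_object[OF th])
  show "quotient_map E N i \<in> gwo_hom \<Theta> (gwo_quotient A S) (gwo_quotient E N)"
    using quotient_map_hom[OF th objects(1,2) S N_ideal homs(1) i_S] .
  show "quotient_map B T p \<in> gwo_hom \<Theta> (gwo_quotient E N) (gwo_quotient B T)"
    using quotient_map_hom[OF th objects(2,3) N_ideal T homs(2) p_N] .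
  show "quotient_map E N s \<in> gwo_hom \<Theta> (gwo_quotient B T) (gwo_quotient E N)"
    using quotient_map_hom[OF th objects(3,2) T N_ideal homs(3) s_T] .
  show "inj_on (quotient_map E N i) (carrier (gwo_quotient A S))"
    by (auto simp: inj_on_def carrier_gwo_quotient induced_coset coset_N_i_eq_iff)
  show "quotient_map B T p ` carrier (gwo_quotient E N) = carrier (gwo_quotient B T)"
    by (simp add: carrier_gwo_quotient image_image induced_coset flip: p_surj)
  show "quotient_map B T p (quotient_map E N s Y) = Y" if "Y \<in> carrier (gwo_quotient B T)" for Y
    using that by (auto simp: carrier_gwo_quotient induced_coset)
  have T_eq: "T #>\<^bsub>B\<^esub> b = T \<longleftrightarrow> b \<in> T" if "b \<in> carrier B" for b
    using that B.r_coset_eq_iff[OF T.subgroup_axioms that B.one_closed] by (simp add: T.subset)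
  show "quotient_map E N i ` carrier (gwo_quotient A S)
      = kernel (gwo_quotient E N) (gwo_quotient B T) (quotient_map B T p)"
  proof
    show "quotient_map E N i ` carrier (gwo_quotient A S)
      \<subseteq> kernel (gwo_quotient E N) (gwo_quotient B T) (quotient_map B T p)"
      using T.subset
      by (auto simp: kernel_def carrier_gwo_quotient induced_coset one_gwo_quotient
          B.coset_mult_one)
    show "kernel (gwo_quotient E N) (gwo_quotient B T) (quotient_map B T p)
      \<subseteq> quotient_map E N i ` carrier (gwo_quotient A S)"
    proof
      fix X assume "X \<in> kernel (gwo_quotient E N) (gwo_quotient B T) (quotient_map B T p)"
      then obtain e where e: "e \<in> carrier E" "X = N #>\<^bsub>E\<^esub> e" "p e \<in> T"
        by (auto simp: kernel_def carrier_gwo_quotient induced_coset one_gwo_quotient T_eq)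
      obtain a where a: "a \<in> carrier A" "e = i a \<otimes>\<^bsub>E\<^esub> s (p e)" using decompose[OF e(1)] .
      have "i a \<otimes>\<^bsub>E\<^esub> s (p e) \<otimes>\<^bsub>E\<^esub> inv\<^bsub>E\<^esub> (i a) \<in> N"
        using normal.inv_op_closed2[OF N_normal _ s_in_N[OF e(3)]] a(1) by simp
      then have "N #>\<^bsub>E\<^esub> e = N #>\<^bsub>E\<^esub> i a"
        using a e(1) by (simp add: E.r_coset_eq_iff[OF N_subgroup])
      then show "X \<in> quotient_map E N i ` carrier (gwo_quotient A S)"
        using a(1) e(2) by (auto simp: carrier_gwo_quotient image_image induced_coset)
    qed
  qed
qed

lemma coset_N_dot:
  assumes "b \<in> carrier B" "a \<in> carrier A"
  shows "N #>\<^bsub>E\<^esub> i (dot b a) =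
    (N #>\<^bsub>E\<^esub> s b) \<otimes>\<^bsub>gwo_quotient E N\<^esub> (N #>\<^bsub>E\<^esub> i a) \<otimes>\<^bsub>gwo_quotient E N\<^esub>
      inv\<^bsub>gwo_quotient E N\<^esub> (N #>\<^bsub>E\<^esub> s b)"
  using assms
  by (simp add: i_action gwo_quotient_inv[OF th objects(2) N_ideal]
      gwo_quotient_coset(1)[OF th objects(2) N_ideal])

lemma coset_N_star:
  assumes "m \<in> binops \<Theta>" "b \<in> carrier B" "a \<in> carrier A"
  shows "N #>\<^bsub>E\<^esub> i (star m b a) = binary (gwo_quotient E N) m (N #>\<^bsub>E\<^esub> s b) (N #>\<^bsub>E\<^esub> i a)"
  using assms by (simp add: i_action gwo_quotient_coset(3)[OF th objects(2) N_ideal])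

lemma coset_N_s_eq:
  assumes "b \<in> carrier B" "b' \<in> carrier B" "T #>\<^bsub>B\<^esub> b = T #>\<^bsub>B\<^esub> b'"
  shows "N #>\<^bsub>E\<^esub> s b = N #>\<^bsub>E\<^esub> s b'"
  using induced_coset(3) assms by metis

text \<open>
  An action on \<open>A\<close> whose class in \<open>E/N\<close> is determined by the classes of the arguments is well
  defined on cosets, because \<open>A/S\<close> embeds in \<open>E/N\<close>.
\<close>

lemma quotient_action_coset:
  assumes closed: "\<And>b a. b \<in> carrier B \<Longrightarrow> a \<in> carrier A \<Longrightarrow> f b a \<in> carrier A"
    and F: "\<And>b a. b \<in> carrier B \<Longrightarrow> a \<in> carrier A \<Longrightarrow>
      N #>\<^bsub>E\<^esub> i (f b a) = F (N #>\<^bsub>E\<^esub> s b) (N #>\<^bsub>E\<^esub> i a)"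
    and b: "b \<in> carrier B" and a: "a \<in> carrier A"
  shows "quotient_action A S f (T #>\<^bsub>B\<^esub> b) (S #>\<^bsub>A\<^esub> a) = S #>\<^bsub>A\<^esub> f b a"
proof -
  have eq: "S #>\<^bsub>A\<^esub> f b' a' = S #>\<^bsub>A\<^esub> f b a" if b': "b' \<in> T #>\<^bsub>B\<^esub> b" and a': "a' \<in> S #>\<^bsub>A\<^esub> a" for b' a'
  proof -
    note b'' = B.r_coset_memE[OF T.subgroup_axioms b' b]
    note a'' = A.r_coset_memE[OF S.subgroup_axioms a' a]
    have "N #>\<^bsub>E\<^esub> i (f b' a') = N #>\<^bsub>E\<^esub> i (f b a)"
      using F[OF b''(1) a''(1)] F[OF b a] coset_N_s_eq[OF b''(1) b b''(2)]
        coset_N_i_eq_iff[OF a''(1) a] a''(2) by simp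
    then show ?thesis using coset_N_i_eq_iff closed a'' b'' a b by blast
  qed
  show ?thesis
    unfolding quotient_action_def
    using B.rcos_self[OF b T.subgroup_axioms] A.rcos_self[OF a S.subgroup_axioms] eq
    by (intro UN_eq_const)
qed

lemma quotient_dot:
  "b \<in> carrier B \<Longrightarrow> a \<in> carrier A \<Longrightarrow>
    quotient_action A S dot (T #>\<^bsub>B\<^esub> b) (S #>\<^bsub>A\<^esub> a) = S #>\<^bsub>A\<^esub> dot b a"
  by (rule quotient_action_coset[where
        F = "\<lambda>X Y. X \<otimes>\<^bsub>gwo_quotient E N\<^esub> Y \<otimes>\<^bsub>gwo_quotient E N\<^esub> inv\<^bsub>gwo_quotient E N\<^esub> X"])
    (simp_all add: action_closed coset_N_dot)

lemma quotient_star: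
  "m \<in> binops \<Theta> \<Longrightarrow> b \<in> carrier B \<Longrightarrow> a \<in> carrier A \<Longrightarrow>
    quotient_action A S (star m) (T #>\<^bsub>B\<^esub> b) (S #>\<^bsub>A\<^esub> a) = S #>\<^bsub>A\<^esub> star m b a"
  by (rule quotient_action_coset[where F = "binary (gwo_quotient E N) m"])
    (simp_all add: action_closed coset_N_star)

lemma derived_actions_quotient:
  "derived_actions \<Theta> (gwo_quotient A S) (gwo_quotient B T)
     (quotient_action A S dot) (\<lambda>m. quotient_action A S (star m))"
proof (rule derived_actionsI[OF th split_extension_quotient])
  show "actions_from \<Theta> (gwo_quotient A S) (gwo_quotient E N) (gwo_quotient B T)
    (quotient_map E N i) (quotient_map E N s)
    (quotient_action A S dot) (\<lambda>m. quotient_action A S (star m))"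
    by (auto simp: actions_from_def carrier_gwo_quotient quotient_dot quotient_star induced_coset
        action_closed coset_N_dot coset_N_star)
qed

end


section \<open>The quotient crossed module\<close>

lemma crossed_module_hom_sub:
  assumes "normal_subcrossed_module \<Theta> S T \<sigma> A B \<alpha> dot star"
  shows "\<alpha> ` S \<subseteq> T"
proof -
  have "\<sigma> \<in> gwo_hom \<Theta> (A\<lparr>carrier := S\<rparr>) (B\<lparr>carrier := T\<rparr>)" and "\<forall>x \<in> S. \<sigma> x = \<alpha> x"
    using assms by (auto simp: normal_subcrossed_module_def subcrossed_module_def crossed_module_def)
  then show ?thesis using gwo_hom_closed by fastforce
qed

text \<open>Conjugation and \<open>\<star>\<close> by \<open>a\<close> in \<open>A\<close> are the actions of \<open>\<alpha>(a)\<close>, under which \<open>S\<close> is stable.\<close>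

lemma normal_subcrossed_module_ideal:
  assumes cm: "crossed_module \<Theta> A B \<alpha> dot star"
    and nsm: "normal_subcrossed_module \<Theta> S T \<sigma> A B \<alpha> dot star"
  shows "gwo_ideal \<Theta> S A"
proof -
  interpret A: group A using cm by (auto simp: crossed_module_def gwo_object_def)
  have sub: "gwo_subobject \<Theta> S A"
    and dotS: "\<And>b x. b \<in> carrier B \<Longrightarrow> x \<in> S \<Longrightarrow> dot b x \<in> S"
    and starS: "\<And>m b x. m \<in> binops \<Theta> \<Longrightarrow> b \<in> carrier B \<Longrightarrow> x \<in> S \<Longrightarrow> star m b x \<in> S"
    using nsm by (auto simp: normal_subcrossed_module_def subcrossed_module_def)
  have S: "subgroup S A" using sub by (simp add: gwo_subobject_def)
  have \<alpha>: "\<alpha> a \<in> carrier B" if "a \<in> carrier A" for a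
    using cm that by (auto simp: crossed_module_def intro: gwo_hom_closed)
  have xc: "x \<in> carrier A" if "x \<in> S" for x using S that by (rule subgroup.mem_carrier)
  have CM2: "dot (\<alpha> a) x = a \<otimes>\<^bsub>A\<^esub> x \<otimes>\<^bsub>A\<^esub> inv\<^bsub>A\<^esub> a" if "a \<in> carrier A" "x \<in> S" for a x
    using cm that xc by (simp add: crossed_module_def)
  have CM3: "star m (\<alpha> a) x = binary A m a x" if "m \<in> binops \<Theta>" "a \<in> carrier A" "x \<in> S" for m a x
    using cm that xc by (simp add: crossed_module_def)
  have "S \<lhd> A"
    using S CM2 dotS \<alpha> A.normal_inv_iff by metis
  moreover have "binary A m a x \<in> S" if "m \<in> binops \<Theta>" "a \<in> carrier A" "x \<in> S" for m a x
    using CM3[OF that] starS \<alpha> that by metis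
  ultimately show ?thesis using sub by (simp add: gwo_ideal_def)
qed

theorem theorem3p15:
  fixes \<Theta> :: "('u, 'o) gwo_theory"
    and A :: "('a, 'u, 'o) gwo" and B :: "('b, 'u, 'o) gwo"
    and \<alpha> \<sigma> :: "'a \<Rightarrow> 'b"
    and dot :: "'b \<Rightarrow> 'a \<Rightarrow> 'a" and star :: "'o \<Rightarrow> 'b \<Rightarrow> 'a \<Rightarrow> 'a"
    and S :: "'a set" and T :: "'b set"
  assumes "groups_with_operations \<Theta>"
    and "crossed_module \<Theta> A B \<alpha> dot star"
    and "normal_subcrossed_module \<Theta> S T \<sigma> A B \<alpha> dot star"
  shows "(\<forall>a \<in> carrier A. quotient_map B T \<alpha> (S #>\<^bsub>A\<^esub> a) = T #>\<^bsub>B\<^esub> \<alpha> a) \<and>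
    (\<forall>b \<in> carrier B. \<forall>a \<in> carrier A.
      quotient_action A S dot (T #>\<^bsub>B\<^esub> b) (S #>\<^bsub>A\<^esub> a) = S #>\<^bsub>A\<^esub> dot b a) \<and>
    (\<forall>m \<in> binops \<Theta>. \<forall>b \<in> carrier B. \<forall>a \<in> carrier A.
      quotient_action A S (star m) (T #>\<^bsub>B\<^esub> b) (S #>\<^bsub>A\<^esub> a) = S #>\<^bsub>A\<^esub> star m b a) \<and>
    crossed_module \<Theta> (gwo_quotient A S) (gwo_quotient B T) (quotient_map B T \<alpha>)
      (quotient_action A S dot) (\<lambda>m. quotient_action A S (star m))"
proof -
  note th = assms(1) and cm = assms(2) and nsm = assms(3)
  have S: "gwo_ideal \<Theta> S A" using cm nsm by (rule normal_subcrossed_module_ideal)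
  have T: "gwo_ideal \<Theta> T B" using nsm by (simp add: normal_subcrossed_module_def)
  have A: "gwo_object \<Theta> A" and B: "gwo_object \<Theta> B" and \<alpha>: "\<alpha> \<in> gwo_hom \<Theta> A B"
    and da: "derived_actions \<Theta> A B dot star"
    using cm by (simp_all add: crossed_module_def)
  obtain E :: "('a \<times> 'b, 'u, 'o) gwo" and i p s
    where E: "split_extension \<Theta> A E B i p s" "actions_from \<Theta> A E B i s dot star"
    using da unfolding derived_actions_def by blast
  interpret split_extension_ideals \<Theta> A E B i p s dot star S T
    using th E S T nsm by unfold_locales (auto simp: normal_subcrossed_module_def)
  have \<alpha>S: "\<alpha> ` S \<subseteq> T" using nsm by (rule crossed_module_hom_sub)
  have map: "quotient_map B T \<alpha> (S #>\<^bsub>A\<^esub> a) = T #>\<^bsub>B\<^esub> \<alpha> a" if "a \<in> carrier A" for a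
    using quotient_map_coset[OF A.group_axioms B.group_axioms \<alpha> S.subgroup_axioms
        T.subgroup_axioms \<alpha>S that] .
  note qA = gwo_quotient_coset[OF th A S] gwo_quotient_inv[OF th A S]
  note qB = gwo_quotient_coset[OF th B T] gwo_quotient_inv[OF th B T]
  have CM:
    "\<And>b a. b \<in> carrier B \<Longrightarrow> a \<in> carrier A \<Longrightarrow> \<alpha> (dot b a) = b \<otimes>\<^bsub>B\<^esub> \<alpha> a \<otimes>\<^bsub>B\<^esub> inv\<^bsub>B\<^esub> b"
    "\<And>a a'. a \<in> carrier A \<Longrightarrow> a' \<in> carrier A \<Longrightarrow> dot (\<alpha> a) a' = a \<otimes>\<^bsub>A\<^esub> a' \<otimes>\<^bsub>A\<^esub> inv\<^bsub>A\<^esub> a"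
    "\<And>m a a'. m \<in> binops \<Theta> \<Longrightarrow> a \<in> carrier A \<Longrightarrow> a' \<in> carrier A \<Longrightarrow>
      star m (\<alpha> a) a' = binary A m a a'"
    "\<And>m b a. m \<in> binops \<Theta> \<Longrightarrow> b \<in> carrier B \<Longrightarrow> a \<in> carrier A \<Longrightarrow>
      \<alpha> (star m b a) = binary B m b (\<alpha> a) \<and> \<alpha> (star (opp \<Theta> m) b a) = binary B m (\<alpha> a) b"
    using cm by (simp_all add: crossed_module_def)
  have "crossed_module \<Theta> (gwo_quotient A S) (gwo_quotient B T) (quotient_map B T \<alpha>)
      (quotient_action A S dot) (\<lambda>m. quotient_action A S (star m))"
    unfolding crossed_module_def
    using gwo_quotient_object[OF th A S] gwo_quotient_object[OF th B T] derived_actions_quotient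
      quotient_map_hom[OF th A B S T \<alpha> \<alpha>S]
    by (auto simp: carrier_gwo_quotient map quotient_dot quotient_star qA qB CM action_closed
        gwo_hom_closed[OF \<alpha>] opp_closed[OF th] binary_opp[OF th B])
  then show ?thesis using map quotient_dot quotient_star by blast
qed

end
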